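(* Let $G$ be a finite simple graph of order $n$ with minimum degree $\delta(G)\geq 2$. Then $$\gamma_{\times 2}(G)+\rho(G)\leq n-\delta(G)+2.$$ Furthermore, this bound is sharp (equality holds for some such graph).
   Context: For a vertex $v$, $N[v]$ is its closed neighbourhood. A set $D\subseteq V(G)$ is a double dominating set if $|N[v]\cap D|\geq 2$ for every $v\in V(G)$; the double domination number $\gamma_{\times 2}(G)$ is the minimum cardinality of a double dominating set. A set $B\subseteq V(G)$ is a packing if $N[u]\cap N[v]=\emptyset$ for all distinct $u,v\in B$; the packing number $\rho(G)$ is the maximum cardinality of a packing. *)

theory Defs
  imports "Graph_Theory.Digraph"
begin

text \<open>
  Finite simple graphs are rendered by the locale \<^locale>\<open>graph\<close>: a finite, loop-free
  digraph without parallel arcs whose adjacency relation is symmetric. Each edge is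
  represented by its two opposite arcs, so the degree of a vertex is its out-degree.
\<close>

definition min_degree :: "('a, 'b) pre_digraph \<Rightarrow> nat" where
  "min_degree G = Min (out_degree G ` verts G)"

definition closed_nbhd :: "('a, 'b) pre_digraph \<Rightarrow> 'a \<Rightarrow> 'a set" where
  "closed_nbhd G v = insert v {u. v \<rightarrow>\<^bsub>G\<^esub> u}"

definition double_dominating :: "('a, 'b) pre_digraph \<Rightarrow> 'a set \<Rightarrow> bool" where
  "double_dominating G D \<longleftrightarrow>
     D \<subseteq> verts G \<and> (\<forall>v \<in> verts G. card (closed_nbhd G v \<inter> D) \<ge> 2)"

text \<open>
  A double dominating set exists iff there is no isolated vertex; without one the
  value of the following \<^const>\<open>Min\<close> is unspecified.
\<close>
definition double_domination_number :: "('a, 'b) pre_digraph \<Rightarrow> nat" where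
  "double_domination_number G = Min (card ` {D. double_dominating G D})"

definition packing :: "('a, 'b) pre_digraph \<Rightarrow> 'a set \<Rightarrow> bool" where
  "packing G B \<longleftrightarrow>
     B \<subseteq> verts G \<and>
     (\<forall>u \<in> B. \<forall>v \<in> B. u \<noteq> v \<longrightarrow> closed_nbhd G u \<inter> closed_nbhd G v = {})"

definition packing_number :: "('a, 'b) pre_digraph \<Rightarrow> nat" where
  "packing_number G = Max (card ` {B. packing G B})"

end

theory Submission
  imports Defs
begin

text \<open>
  A closed neighbourhood has at least \<open>\<delta> + 1\<close> vertices and meets a packing \<open>B\<close> in at most
  one. Hence, after deleting \<open>B\<close> and any \<open>\<delta> - 2\<close> further vertices, every closed neighbourhood
  retains at least two vertices, so what is left is double dominating. The triangle attains
  equality.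
\<close>

lemma (in wf_digraph) closed_nbhd_subset_verts:
  "v \<in> verts G \<Longrightarrow> closed_nbhd G v \<subseteq> verts G"
  by (auto simp: closed_nbhd_def dest: adj_in_verts)

lemma (in graph) mem_closed_nbhd_commute:
  "u \<in> closed_nbhd G v \<longleftrightarrow> v \<in> closed_nbhd G u"
  using sym_arcs by (auto simp: closed_nbhd_def symmetric_def dest: symD)

text \<open>\<open>out_degree\<close> counts arcs, whereas \<open>closed_nbhd\<close> collects
  vertices. Without parallel arcs \<open>head G\<close> is injective on the out-arcs of
  \<open>v\<close>, so the two counts agree; without loops \<open>v\<close> is not its own neighbour
  and contributes the extra one.\<close>

lemma (in digraph) card_closed_nbhd:
  assumes "v \<in> verts G"
  shows "card (closed_nbhd G v) = Suc (out_degree G v)"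
proof -
  have "{u. v \<rightarrow>\<^bsub>G\<^esub> u} = head G ` out_arcs G v"
    by (auto simp: arcs_ends_def arc_to_ends_def image_iff)
  moreover have "inj_on (head G) (out_arcs G v)"
    by (auto simp: inj_on_def arc_to_ends_def intro: no_multi_arcs)
  moreover have "v \<notin> {u. v \<rightarrow>\<^bsub>G\<^esub> u}"
    using adj_not_same by auto
  moreover have "finite (out_arcs G v)"
    by (rule finite_subset[OF _ finite_arcs]) auto
  ultimately show ?thesis
    by (simp add: closed_nbhd_def out_degree_def card_image)
qed

lemma (in digraph) min_degree_less_card_closed_nbhd:
  "v \<in> verts G \<Longrightarrow> min_degree G < card (closed_nbhd G v)"
  by (simp add: card_closed_nbhd min_degree_def less_Suc_eq_le)

text \<open>If \<open>x\<close> and \<open>y\<close> in \<open>B\<close> both lie in the closed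
  neighbourhood of \<open>v\<close>, then by symmetry \<open>v\<close> lies in those of
  \<open>x\<close> and \<open>y\<close>. These intersect, so the packing condition forces
  \<open>x = y\<close>.\<close>

lemma (in graph) card_closed_nbhd_Int_packing_le_1:
  assumes "packing G B"
  shows "card (closed_nbhd G v \<inter> B) \<le> 1"
proof -
  have "x = y" if "x \<in> closed_nbhd G v \<inter> B" "y \<in> closed_nbhd G v \<inter> B" for x y
    using assms that unfolding packing_def by (metis IntD1 IntD2 IntI empty_iff mem_closed_nbhd_commute)
  moreover have "finite (closed_nbhd G v \<inter> B)"
    using assms by (auto simp: packing_def intro: finite_subset[OF _ finite_verts])
  ultimately show ?thesis
    by (simp add: card_le_Suc0_iff_eq)
qed

lemma (in graph) double_dominating_Diff_packing:
  assumes "packing G B" "card S + 2 \<le> min_degree G" "finite S"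
  shows "double_dominating G (verts G - (B \<union> S))"
  unfolding double_dominating_def
proof (intro conjI ballI)
  fix v assume v: "v \<in> verts G"
  let ?N = "closed_nbhd G v"
  have N: "?N \<subseteq> verts G" "finite ?N"
    using closed_nbhd_subset_verts[OF v] finite_subset[OF _ finite_verts] by auto
  have "?N \<inter> (verts G - (B \<union> S)) = ?N - ((?N \<inter> B) \<union> (?N \<inter> S))"
    using N by auto
  moreover have "card ((?N \<inter> B) \<union> (?N \<inter> S)) \<le> 1 + card S"
    using card_closed_nbhd_Int_packing_le_1[OF assms(1), of v]
      card_mono[OF assms(3), of "?N \<inter> S"] card_Un_le[of "?N \<inter> B" "?N \<inter> S"] by auto
  \<comment> \<open>At least \<delta> + 1 vertices, less at most 1 + \<open>card S\<close> \<le>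
    \<delta> - 1 deleted ones, leave at least 2.\<close>
  ultimately show "2 \<le> card (?N \<inter> (verts G - (B \<union> S)))"
    using diff_card_le_card_Diff[of "(?N \<inter> B) \<union> (?N \<inter> S)" ?N] N assms(2)
      min_degree_less_card_closed_nbhd[OF v] by simp
qed auto

lemma (in fin_digraph) finite_packings: "finite {B. packing G B}"
  by (rule finite_subset[of _ "Pow (verts G)"]) (auto simp: packing_def)

lemma (in fin_digraph) finite_double_dominating: "finite {D. double_dominating G D}"
  by (rule finite_subset[of _ "Pow (verts G)"]) (auto simp: double_dominating_def)

text \<open>The empty packing makes the family under \<open>Max\<close> nonempty, so the maximum is
  one of its values.\<close>

lemma (in fin_digraph) packing_number_attained:
  obtains B where "packing G B" "card B = packing_number G"
proof -
  have "packing G {}"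
    by (simp add: packing_def)
  then have "packing_number G \<in> card ` {B. packing G B}"
    unfolding packing_number_def using finite_packings by (intro Max_in) auto
  then show ?thesis
    using that by auto
qed

lemma (in fin_digraph) double_domination_number_le:
  "double_dominating G D \<Longrightarrow> double_domination_number G \<le> card D"
  unfolding double_domination_number_def using finite_double_dominating by (intro Min_le) auto

text \<open>The minimum degree stands on the left so that the inequality involves no truncated
  subtraction on \<open>nat\<close>.\<close>

lemma (in graph) double_domination_plus_packing_le:
  assumes "verts G \<noteq> {}" "min_degree G \<ge> 2"
  shows "double_domination_number G + packing_number G + min_degree G \<le> card (verts G) + 2"
proof -
  obtain B where B: "packing G B" "card B = packing_number G"
    by (rule packing_number_attained)
  have BV: "B \<subseteq> verts G" "finite B"
    using B finite_subset[OF _ finite_verts] by (auto simp: packing_def)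
  \<comment> \<open>Any vertex will do: its closed neighbourhood has at least \<delta> vertices
    outside \<open>B\<close>, enough to choose the \<delta> - 2 vertices of \<open>S\<close>
    disjoint from \<open>B\<close>.\<close>
  obtain w where w: "w \<in> verts G"
    using assms by auto
  let ?N = "closed_nbhd G w"
  have N: "?N \<subseteq> verts G" "finite ?N"
    using closed_nbhd_subset_verts[OF w] finite_subset[OF _ finite_verts] by auto
  have "min_degree G - 2 \<le> card (?N - ?N \<inter> B)"
    using diff_card_le_card_Diff[of "?N \<inter> B" ?N] N min_degree_less_card_closed_nbhd[OF w]
      card_closed_nbhd_Int_packing_le_1[OF B(1), of w] by simp
  then obtain S where S: "S \<subseteq> ?N - ?N \<inter> B" "card S = min_degree G - 2" "finite S"
    by (rule obtain_subset_with_card_n)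
  have "double_domination_number G \<le> card (verts G - (B \<union> S))"
    using B(1) S assms(2) by (intro double_domination_number_le double_dominating_Diff_packing) auto
  also have "\<dots> = card (verts G) - card (B \<union> S)"
    using BV S N by (intro card_Diff_subset) auto
  also have "card (B \<union> S) = card B + card S"
    using BV S by (intro card_Un_disjoint) auto
  finally have "double_domination_number G \<le> card (verts G) - (card B + card S)" .
  \<comment> \<open>This makes the natural-number subtraction above exact.\<close>
  moreover have "card (B \<union> S) \<le> card (verts G)"
    using BV S N finite_verts by (intro card_mono) auto
  moreover have "card (B \<union> S) = card B + card S"
    using BV S by (intro card_Un_disjoint) auto
  ultimately show ?thesis
    using B(2) S(2) assms(2) by linarith
qed

text \<open>Each arc is the pair of its own ends, which excludes parallel arcs at once; both
  orientations of every edge are present, as \<open>graph\<close> requires.\<close>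

definition triangle :: "(nat, nat \<times> nat) pre_digraph" where
  "triangle = \<lparr>verts = {0, 1, 2}, arcs = {(i, j). i < 3 \<and> j < 3 \<and> i \<noteq> j}, tail = fst, head = snd\<rparr>"

lemma arcs_ends_triangle: "arcs_ends triangle = {(i, j). i < 3 \<and> j < 3 \<and> i \<noteq> j}"
  by (auto simp: triangle_def arcs_ends_def arc_to_ends_def)

lemma verts_triangle: "verts triangle = {..<3}"
  by (auto simp: triangle_def)

lemma graph_triangle: "graph triangle"
proof unfold_locales
  show "finite (arcs triangle)"
    by (rule finite_subset[of _ "{..<3} \<times> {..<3}"]) (auto simp: triangle_def)
  show "symmetric triangle"
    unfolding symmetric_def arcs_ends_triangle by (auto simp: sym_def)
qed (auto simp: triangle_def arc_to_ends_def)

lemma closed_nbhd_triangle: "v < 3 \<Longrightarrow> closed_nbhd triangle v = {..<3}"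
  by (auto simp: closed_nbhd_def arcs_ends_triangle)

lemma min_degree_triangle: "min_degree triangle = 2"
proof -
  interpret graph triangle
    by (rule graph_triangle)
  \<comment> \<open>The degree is read off from the closed neighbourhood, which has 3 elements,
    instead of counting arcs.\<close>
  have "out_degree triangle v = 2" if "v \<in> verts triangle" for v
    using card_closed_nbhd[OF that] that by (simp add: verts_triangle closed_nbhd_triangle)
  then have "out_degree triangle ` verts triangle = (\<lambda>_. 2) ` verts triangle"
    by (rule image_cong[OF refl])
  also have "\<dots> = {2}"
    by (simp add: image_constant_conv verts_triangle lessThan_empty_iff)
  finally show ?thesis
    by (simp add: min_degree_def)
qed

lemma packing_number_triangle_ge: "1 \<le> packing_number triangle"
proof -
  interpret graph triangle
    by (rule graph_triangle)
  have "packing triangle {0}"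
    by (simp add: packing_def verts_triangle)
  then show ?thesis
    unfolding packing_number_def using finite_packings
    by (intro Max_ge) (auto intro!: image_eqI[of _ _ "{0}"])
qed

lemma double_domination_number_triangle_ge: "2 \<le> double_domination_number triangle"
proof -
  interpret graph triangle
    by (rule graph_triangle)
  have dd: "double_dominating triangle D \<longleftrightarrow> D \<subseteq> {..<3} \<and> 2 \<le> card D" for D
    using lessThan_empty_iff[of "3::nat"]
    by (auto simp: double_dominating_def verts_triangle closed_nbhd_triangle Int_absorb1)
  \<comment> \<open>This witness ensures that \<open>Min\<close> ranges over a nonempty family and
    so is attained.\<close>
  have "double_dominating triangle {..<3}"
    by (simp add: dd)
  then have "double_domination_number triangle \<in> card ` {D. double_dominating triangle D}"
    unfolding double_domination_number_def
    by (intro Min_in finite_imageI finite_double_dominating) auto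
  then show ?thesis
    by (auto simp: dd)
qed

theorem theorem4:
  shows "(\<forall>G :: ('a, 'b) pre_digraph.
            graph G \<and> verts G \<noteq> {} \<and> min_degree G \<ge> 2 \<longrightarrow>
            int (double_domination_number G) + int (packing_number G)
              \<le> int (card (verts G)) - int (min_degree G) + 2)
       \<and> (\<exists>H :: (nat, nat \<times> nat) pre_digraph.
            graph H \<and> verts H \<noteq> {} \<and> min_degree H \<ge> 2 \<and>
            int (double_domination_number H) + int (packing_number H)
              = int (card (verts H)) - int (min_degree H) + 2)"
proof (intro conjI allI impI)
  fix G :: "('a, 'b) pre_digraph"
  assume G: "graph G \<and> verts G \<noteq> {} \<and> min_degree G \<ge> 2"
  then interpret graph G
    by simp
  show "int (double_domination_number G) + int (packing_number G)
          \<le> int (card (verts G)) - int (min_degree G) + 2"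
    using double_domination_plus_packing_le G by linarith
next
  interpret triangle: graph triangle
    by (rule graph_triangle)
  have "verts triangle \<noteq> {}" "card (verts triangle) = 3"
    by (simp_all add: verts_triangle lessThan_empty_iff)
  then show "\<exists>H :: (nat, nat \<times> nat) pre_digraph.
            graph H \<and> verts H \<noteq> {} \<and> min_degree H \<ge> 2 \<and>
            int (double_domination_number H) + int (packing_number H)
              = int (card (verts H)) - int (min_degree H) + 2"
    \<comment> \<open>With n = 3 and \<delta> = 2 the general bound says that the sum is at most 3,
      while the two lower bounds give at least 2 + 1.\<close>
    using triangle.double_domination_plus_packing_le min_degree_triangle
      packing_number_triangle_ge double_domination_number_triangle_ge graph_triangle
    by (intro exI[of _ triangle]) auto
qed

end
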